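(* Let $R$ be an integral domain with unit, $p,q\in R$, $U=(U_n)$ with $U_0=0$, $U_1=1$, $U_n=pU_{n-1}-qU_{n-2}$, and $x_n=U_n/U_{n-1}$ for $n\ge2$. Let $f(t)=t^2-pt+q$, let $d\ge1$ be an integer, and consider the Householder iteration $$y_{m+1}=y_m+d\,\frac{(1/f)^{(d-1)}(y_m)}{(1/f)^{(d)}(y_m)},$$ where $(1/f)^{(j)}$ denotes the $j$-th derivative of the rational function $1/f$. If $y_m=x_k$ for some $k\ge2$, then $y_{m+1}=x_{(d+1)k-d}$ (whenever the quantities are defined).
   Context: For $d=1$ the Householder iteration is Newton's method and for $d=2$ it is Halley's method. *)

theory Defs
  imports "HOL-Computational_Algebra.Computational_Algebra"
begin

fun lucas_U :: "'a::idom \<Rightarrow> 'a \<Rightarrow> nat \<Rightarrow> 'a" where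
  "lucas_U p q 0 = 0"
| "lucas_U p q (Suc 0) = 1"
| "lucas_U p q (Suc (Suc n)) = p * lucas_U p q (Suc n) - q * lucas_U p q n"

text \<open>The ratio lives in the fraction field of the domain. It is meaningful for
  \<open>n \<ge> 2\<close> with \<open>lucas_U p q (n - 1) \<noteq> 0\<close>; otherwise \<^const>\<open>Fract\<close>
  returns the junk value 0.\<close>

definition lucas_ratio :: "'a::idom \<Rightarrow> 'a \<Rightarrow> nat \<Rightarrow> 'a fract" where
  "lucas_ratio p q n = Fract (lucas_U p q n) (lucas_U p q (n - 1))"

definition lucas_poly :: "'a::idom \<Rightarrow> 'a \<Rightarrow> 'a fract poly" where
  "lucas_poly p q = [:to_fract q, - to_fract p, 1:]"

text \<open>Rational functions over a field \<open>K\<close> are elements of the fraction field of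
  \<open>K[t]\<close>. The derivative is formal, given by the quotient rule on representatives.\<close>

definition ratfun_deriv :: "'k::field poly fract \<Rightarrow> 'k poly fract" where
  "ratfun_deriv r = (THE s. \<exists>a b. b \<noteq> 0 \<and> r = Fract a b \<and>
     s = Fract (pderiv a * b - a * pderiv b) (b\<^sup>2))"

lemma ratfun_deriv_Fract:
  fixes a b :: "'k::field poly"
  assumes b: "b \<noteq> 0"
  shows "ratfun_deriv (Fract a b) = Fract (pderiv a * b - a * pderiv b) (b\<^sup>2)"
  unfolding ratfun_deriv_def
proof (rule the_equality)
  show "\<exists>a' b'. b' \<noteq> 0 \<and> Fract a b = Fract a' b' \<and>
      Fract (pderiv a * b - a * pderiv b) (b\<^sup>2) =
      Fract (pderiv a' * b' - a' * pderiv b') (b'\<^sup>2)"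
    using b by blast
next
  fix s
  assume "\<exists>a' b'. b' \<noteq> 0 \<and> Fract a b = Fract a' b' \<and>
      s = Fract (pderiv a' * b' - a' * pderiv b') (b'\<^sup>2)"
  then obtain c d where d: "d \<noteq> 0" and eF: "Fract a b = Fract c d"
    and s: "s = Fract (pderiv c * d - c * pderiv d) (d\<^sup>2)" by blast
  have e: "a * d = c * b" using eF b d by (simp add: eq_fract)
  have "pderiv (a * d) = pderiv (c * b)" by (simp only: e)
  then have e': "pderiv a * d + a * pderiv d = pderiv c * b + c * pderiv b"
    by (simp add: pderiv_mult algebra_simps)
  have "(pderiv a * b - a * pderiv b) * d\<^sup>2 - (pderiv c * d - c * pderiv d) * b\<^sup>2
      = (pderiv a * d + a * pderiv d - (pderiv c * b + c * pderiv b)) * (b * d)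
        - (a * d - c * b) * (b * pderiv d + d * pderiv b)"
    by (simp add: algebra_simps power2_eq_square)
  then have "(pderiv a * b - a * pderiv b) * d\<^sup>2 = (pderiv c * d - c * pderiv d) * b\<^sup>2"
    by (simp add: e e')
  with b d show "s = Fract (pderiv a * b - a * pderiv b) (b\<^sup>2)"
    by (simp add: s eq_fract)
qed

definition ratfun_regular_at :: "'k::field poly fract \<Rightarrow> 'k \<Rightarrow> bool" where
  "ratfun_regular_at r z \<longleftrightarrow> (\<exists>a b. r = Fract a b \<and> poly b z \<noteq> 0)"

definition ratfun_eval :: "'k::field poly fract \<Rightarrow> 'k \<Rightarrow> 'k" where
  "ratfun_eval r z =
     (THE v. \<exists>a b. r = Fract a b \<and> poly b z \<noteq> 0 \<and> v = poly a z / poly b z)"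

lemma ratfun_eval_Fract:
  assumes "poly b z \<noteq> 0"
  shows "ratfun_eval (Fract a b) z = poly a z / poly b z"
  unfolding ratfun_eval_def
proof (rule the_equality)
  show "\<exists>a' b'. Fract a b = Fract a' b' \<and> poly b' z \<noteq> 0
          \<and> poly a z / poly b z = poly a' z / poly b' z"
    using assms by blast
next
  fix v
  assume "\<exists>a' b'. Fract a b = Fract a' b' \<and> poly b' z \<noteq> 0 \<and> v = poly a' z / poly b' z"
  then obtain c d where e: "Fract a b = Fract c d" and d: "poly d z \<noteq> 0"
    and v: "v = poly c z / poly d z" by blast
  have "b \<noteq> 0" "d \<noteq> 0" using assms d by auto
  with e have "a * d = c * b" by (simp add: eq_fract)
  then have "poly (a * d) z = poly (c * b) z" by simp
  with assms d show "v = poly a z / poly b z"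
    unfolding v by (simp add: frac_eq_eq)
qed

text \<open>The \<open>j\<close>-th derivative of \<open>1/f\<close>.\<close>

definition recip_deriv :: "nat \<Rightarrow> 'k::field poly \<Rightarrow> 'k poly fract" where
  "recip_deriv j f = (ratfun_deriv ^^ j) (1 / to_fract f)"

definition householder_defined :: "nat \<Rightarrow> 'k::field poly \<Rightarrow> 'k \<Rightarrow> bool" where
  "householder_defined d f z \<longleftrightarrow>
     ratfun_regular_at (recip_deriv (d - 1) f) z \<and>
     ratfun_regular_at (recip_deriv d f) z \<and>
     ratfun_eval (recip_deriv d f) z \<noteq> 0"

definition householder_step :: "nat \<Rightarrow> 'k::field poly \<Rightarrow> 'k \<Rightarrow> 'k" where
  "householder_step d f z =
     z + of_nat d * (ratfun_eval (recip_deriv (d - 1) f) z / ratfun_eval (recip_deriv d f) z)"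

end

(* The Taylor coefficients M_j of 1/f, scaled by f^(j+1), satisfy the Lucas recurrence
   M_(j+2) = - f' M_(j+1) - f M_j, because f(t + h) = f(t) + f'(t) h + h^2. The Householder step
   is therefore (z M_d + f M_(d-1)) / M_d, evaluated at z. The characteristic roots of this
   recurrence at z are a - z and b - z, where a, b are the roots of f. For z = U_(n+1) / U_n they
   equal - b^n / U_n and - a^n / U_n, so that M_d(z) is U_((d+1)n) up to the factor
   (- 1)^d U_n^(d+1). *)

theory Submission
  imports Defs
begin

text \<open>This and \<open>lucas_U_add'\<close> compare the first columns in C^m C^n = C^(m+n),
  where C = [[p, -q], [1, 0]] is the companion matrix.\<close>

lemma lucas_U_add:
  "lucas_U p q (Suc (m + n)) = lucas_U p q (Suc m) * lucas_U p q (Suc n) - q * lucas_U p q m * lucas_U p q n"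
proof (induction p q n rule: lucas_U.induct)
  case (3 p q n)
  have "lucas_U p q (Suc (m + Suc (Suc n))) =
      p * lucas_U p q (Suc (m + Suc n)) - q * lucas_U p q (Suc (m + n))"
    by simp
  then show ?case unfolding 3 by (simp add: algebra_simps)
qed simp_all

text \<open>The matrix product has - q U_(m-1) as a coefficient; writing it as U_(m+1) - p U_m
  lowers no index.\<close>

lemma lucas_U_add':
  "lucas_U p q (m + n) = lucas_U p q m * lucas_U p q (Suc n) + lucas_U p q (Suc m) * lucas_U p q n
     - p * lucas_U p q m * lucas_U p q n"
proof (cases n)
  case (Suc l)
  then show ?thesis using lucas_U_add[of p q m l] by (simp add: algebra_simps)
qed simp

lemma to_fract_lucas_U: "to_fract (lucas_U p q n) = lucas_U (to_fract p) (to_fract q) n"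
  by (induction p q n rule: lucas_U.induct) simp_all

lemma poly_lucas_U: "poly (lucas_U P Q n) z = lucas_U (poly P z) (poly Q z) n"
  by (induction P Q n rule: lucas_U.induct) simp_all

text \<open>With C the companion matrix, the hypothesis says C^n = U_n A for A = C + (z - p) I.
  Since -A has trace p - 2z and determinant z^2 - pz + q, its powers are governed by
  \<open>V\<close>. The two claims are the first column of C^((e+1)n); each addition formula uses
  both, so they are proved together.\<close>

lemma lucas_U_mult_index:
  fixes p q z :: "'a::idom"
  assumes z: "lucas_U p q (Suc n) = z * lucas_U p q n"
  defines "V \<equiv> lucas_U (p - 2 * z) (z\<^sup>2 - p * z + q)"
  shows "lucas_U p q (Suc e * n) = (- 1) ^ e * lucas_U p q n ^ Suc e * V (Suc e)
     \<and> lucas_U p q (Suc (Suc e * n)) =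
         (- 1) ^ e * lucas_U p q n ^ Suc e * (z * V (Suc e) + (z\<^sup>2 - p * z + q) * V e)"
proof (induction e)
  case 0
  then show ?case by (simp add: V_def z)
next
  case (Suc e)
  define u where "u = lucas_U p q n"
  define s where "s = (- 1) ^ e * u ^ Suc e"
  define f where "f = z\<^sup>2 - p * z + q"
  have V: "V (Suc (Suc e)) = (p - 2 * z) * V (Suc e) - f * V e"
    by (simp add: V_def f_def)
  have IH: "lucas_U p q (Suc e * n) = s * V (Suc e)"
    "lucas_U p q (Suc (Suc e * n)) = s * (z * V (Suc e) + f * V e)"
    using Suc by (simp_all only: s_def u_def f_def)
  have i: "Suc (Suc e) * n = Suc e * n + n" by simp
  have z': "lucas_U p q (Suc n) = z * u" by (simp add: z u_def)
  have "lucas_U p q (Suc (Suc e) * n) = - s * u * V (Suc (Suc e))"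
    unfolding i lucas_U_add' IH z' V u_def[symmetric] by (simp add: algebra_simps)
  moreover have "lucas_U p q (Suc (Suc (Suc e) * n))
      = - s * u * (z * V (Suc (Suc e)) + f * V (Suc e))"
    unfolding i lucas_U_add IH z' V u_def[symmetric]
    by (simp add: algebra_simps f_def power2_eq_square)
  moreover have "(- 1) ^ Suc e * u ^ Suc (Suc e) = - s * u" by (simp add: s_def)
  ultimately show ?case by (simp only: u_def[symmetric] f_def[symmetric])
qed

text \<open>For f = (t - a)(t - b) the left-hand Lucas term is the sum of (a - t)^i (b - t)^(j-i)
  over i \<le> j. Both bases have derivative -1, and each monomial of degree j - 1 arises with total
  weight (i + 1) + (j - i) = j + 1.\<close>

lemma pderiv_lucas_U:
  fixes f :: "'k::field poly"
  assumes "pderiv (pderiv f) = 2"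
  shows "pderiv (lucas_U (- pderiv f) f (Suc j)) = - of_nat (Suc j) * lucas_U (- pderiv f) f j"
proof (induction j rule: less_induct)
  case (less j)
  show ?case
  proof (cases j)
    case (Suc i)
    define M where "M = lucas_U (- pderiv f) f"
    have R: "M (Suc (Suc l)) = - pderiv f * M (Suc l) - f * M l" for l
      by (simp add: M_def)
    have d1: "pderiv (M (Suc i)) = - of_nat (Suc i) * M i"
      unfolding M_def using Suc by (intro less) simp
    \<comment> \<open>At \<open>i = 0\<close> the truncated index is harmless: both sides are
      0.\<close>
    have d0: "pderiv (M i) = - of_nat i * M (i - 1)"
    proof (cases i)
      case 0
      then show ?thesis by (simp add: M_def)
    next
      case (Suc l)
      then show ?thesis using less[of l] \<open>j = Suc i\<close> unfolding M_def by simp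
    qed
    \<comment> \<open>The factor \<open>of_nat i\<close> extends the recurrence to
      \<open>i = 0\<close>, where it would fail by itself.\<close>
    have r: "of_nat i * M (Suc i) = of_nat i * (- pderiv f * M i - f * M (i - 1))"
      by (cases i) (simp_all add: R)
    have "pderiv (M (Suc (Suc i))) =
        - pderiv f * pderiv (M (Suc i)) - 2 * M (Suc i) - pderiv f * M i - f * pderiv (M i)"
      unfolding R by (simp add: pderiv_mult pderiv_diff pderiv_minus assms algebra_simps)
    also have "\<dots> = - 2 * M (Suc i) + of_nat i * (pderiv f * M i + f * M (i - 1))"
      unfolding d0 d1 by (simp add: algebra_simps)
    also have "\<dots> = - 2 * M (Suc i) - of_nat i * M (Suc i)"
      unfolding r by (simp add: algebra_simps)
    also have "\<dots> = - of_nat (Suc (Suc i)) * M (Suc i)"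
      by (simp add: algebra_simps)
    finally show ?thesis by (simp only: M_def Suc)
  qed simp
qed

text \<open>The Taylor coefficient of index j, scaled by f^(j+1), is the Lucas term of index
  \<open>Suc j\<close>. In the quotient rule, \<open>pderiv_lucas_U\<close> turns the numerator into
  (j + 1) f^j times the right side of the recurrence, and f^j cancels.\<close>

lemma recip_deriv_eq:
  fixes f :: "'k::field poly"
  assumes f: "pderiv (pderiv f) = 2" "f \<noteq> 0"
  shows "recip_deriv j f = Fract (of_nat (fact j) * lucas_U (- pderiv f) f (Suc j)) (f ^ Suc j)"
proof (induction j)
  case 0
  have "1 / to_fract f = Fract 1 f" by (simp add: to_fract_def One_fract_def)
  then show ?case by (simp add: recip_deriv_def)
next
  case (Suc j)
  define c :: "'k poly" where "c = of_nat (fact j)"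
  define M where "M = lucas_U (- pderiv f) f"
  have c': "pderiv c = 0" unfolding c_def by (rule pderiv_of_nat)
  have "recip_deriv (Suc j) f = ratfun_deriv (recip_deriv j f)"
    by (simp add: recip_deriv_def)
  also have "\<dots> = ratfun_deriv (Fract (c * M (Suc j)) (f ^ Suc j))"
    by (simp only: Suc c_def M_def)
  also have "\<dots> = Fract (pderiv (c * M (Suc j)) * f ^ Suc j - c * M (Suc j) * pderiv (f ^ Suc j))
      ((f ^ Suc j)\<^sup>2)"
    using f by (intro ratfun_deriv_Fract) simp
  also have "pderiv (c * M (Suc j)) = - (of_nat (Suc j) * c * M j)"
    unfolding pderiv_mult c' M_def pderiv_lucas_U[OF f(1)]
    by (simp only: mult_zero_right add_0_right) (simp add: algebra_simps)
  also have "pderiv (f ^ Suc j) = of_nat (Suc j) * f ^ j * pderiv f"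
    unfolding pderiv_power_Suc by (simp add: of_nat_poly algebra_simps smult_add_left)
  also have "- (of_nat (Suc j) * c * M j) * f ^ Suc j - c * M (Suc j) * (of_nat (Suc j) * f ^ j * pderiv f)
      = (of_nat (Suc j) * c * M (Suc (Suc j))) * f ^ j"
    by (simp add: M_def algebra_simps)
  also have "(f ^ Suc j)\<^sup>2 = f ^ Suc (Suc j) * f ^ j"
    by (simp add: power2_eq_square algebra_simps)
  also have "Fract (of_nat (Suc j) * c * M (Suc (Suc j)) * f ^ j) (f ^ Suc (Suc j) * f ^ j)
      = Fract (of_nat (Suc j) * c * M (Suc (Suc j))) (f ^ Suc (Suc j))"
    using f by (simp add: eq_fract)
  also have "of_nat (Suc j) * c = of_nat (fact (Suc j))"
    by (simp add: c_def algebra_simps)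
  finally show ?case by (simp only: M_def)
qed

text \<open>A fraction need not be reduced, so a zero of its denominator is a pole only if the
  numerator survives there. Cross-multiplying with a representative that is regular at
  \<open>z\<close> shows this.\<close>

lemma ratfun_regular_at_Fract_zero:
  assumes "ratfun_regular_at (Fract a b) z" "b \<noteq> 0" "poly b z = 0"
  shows "poly a z = 0"
proof -
  obtain c d where e: "Fract a b = Fract c d" and d: "poly d z \<noteq> 0"
    using assms(1) unfolding ratfun_regular_at_def by blast
  have "d \<noteq> 0" using d by auto
  then have "a * d = c * b" using e assms(2) by (simp add: eq_fract)
  then have "poly (a * d) z = poly (c * b) z" by simp
  then show ?thesis using d assms(3) by simp
qed

lemma householder_step_eq:
  fixes f :: "'k::field poly"
  assumes f: "pderiv (pderiv f) = 2" "f \<noteq> 0"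
    and d: "d \<ge> 1"
    and "householder_defined d f z"
    and M: "lucas_U (- poly (pderiv f) z) (poly f z) (Suc d) \<noteq> 0"
  shows "householder_step d f z = z + poly f z *
    (lucas_U (- poly (pderiv f) z) (poly f z) d / lucas_U (- poly (pderiv f) z) (poly f z) (Suc d))"
proof -
  define V where "V = lucas_U (- poly (pderiv f) z) (poly f z)"
  note R = recip_deriv_eq[OF f]
  have reg: "ratfun_regular_at (recip_deriv d f) z"
    and ev: "ratfun_eval (recip_deriv d f) z \<noteq> 0"
    using assms(4) by (simp_all add: householder_defined_def)
  \<comment> \<open>In positive characteristic at most d, the d-th derivative would vanish
    identically, against \<open>ev\<close>.\<close>
  have c: "(of_nat (fact d) :: 'k) \<noteq> 0"
  proof
    assume "(of_nat (fact d) :: 'k) = 0"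
    then have "recip_deriv d f = Fract 0 1"
      using R[of d] f(2) by (simp add: of_nat_poly eq_fract)
    then show False using ev by (simp add: ratfun_eval_Fract)
  qed
  \<comment> \<open>At a zero of \<open>f\<close>, regularity would force the numerator d! M_d to
    vanish, against \<open>c\<close> and \<open>M\<close>.\<close>
  have fz: "poly f z \<noteq> 0"
  proof
    assume "poly f z = 0"
    then have "poly (of_nat (fact d) * lucas_U (- pderiv f) f (Suc d)) z = 0"
      using ratfun_regular_at_Fract_zero[OF reg[unfolded R]] f(2) by (simp only: poly_power) simp
    then have "of_nat (fact d) * lucas_U (- poly (pderiv f) z) (poly f z) (Suc d) = 0"
      by (simp only: poly_mult poly_of_nat poly_lucas_U poly_minus)
    then show False using c M mult_eq_0_iff by blast
  qed
  have E: "ratfun_eval (recip_deriv j f) z = of_nat (fact j) * V (Suc j) / poly f z ^ Suc j" for j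
    unfolding R using fz
    by (subst ratfun_eval_Fract) (simp_all add: poly_lucas_U V_def del: lucas_U.simps of_nat_fact)
  obtain e where e: "d = Suc e" using d by (cases d) auto
  \<comment> \<open>The factor d of the step absorbs the quotient of the factorials (d - 1)! and
    d!.\<close>
  have ce: "(of_nat (fact d) :: 'k) = of_nat d * of_nat (fact e)"
    by (simp add: e algebra_simps)
  have "of_nat d * (of_nat (fact e) * V d / poly f z ^ d / (of_nat (fact d) * V (Suc d) / poly f z ^ Suc d))
      = poly f z * (V d / V (Suc d))"
    using c fz M unfolding ce by (simp add: V_def[symmetric] field_simps)
  then show ?thesis
    unfolding householder_step_def E V_def[symmetric] by (simp add: e)
qed

theorem theorem3p3:
  fixes p q :: "'a::idom" and y :: "nat \<Rightarrow> 'a fract" and d k m :: nat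
  assumes "d \<ge> 1" and "k \<ge> 2"
    and "lucas_U p q (k - 1) \<noteq> 0"
    and "lucas_U p q ((d + 1) * k - d - 1) \<noteq> 0"
    and "householder_defined d (lucas_poly p q) (y m)"
    and "y (Suc m) = householder_step d (lucas_poly p q) (y m)"
    and "y m = lucas_ratio p q k"
  shows "y (Suc m) = lucas_ratio p q ((d + 1) * k - d)"
proof -
  \<comment> \<open>Shifting by one makes the target index (d + 1) n + 1, so its denominator has
    index (d + 1) n.\<close>
  obtain n where n: "k = Suc n" using assms(2) by (cases k) auto
  have idx: "(d + 1) * k - d - 1 = Suc d * n" "(d + 1) * k - d = Suc (Suc d * n)"
    by (simp_all add: n)
  define P where "P = to_fract p"
  define Q where "Q = to_fract q"
  define z where "z = y m"
  define F where "F = lucas_poly p q"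
  define V where "V = lucas_U (P - 2 * z) (z\<^sup>2 - P * z + Q)"
  have ratio: "lucas_ratio p q (Suc j) = lucas_U P Q (Suc j) / lucas_U P Q j" for j
    by (simp add: lucas_ratio_def Fract_conv_to_fract to_fract_lucas_U P_def Q_def del: lucas_U.simps)
  have Un: "lucas_U P Q n \<noteq> 0"
    using assms(3) unfolding n P_def Q_def to_fract_lucas_U[symmetric] by simp
  have UN: "lucas_U P Q (Suc d * n) \<noteq> 0"
    using assms(4) unfolding idx P_def Q_def to_fract_lucas_U[symmetric] by simp
  have z: "lucas_U P Q (Suc n) = z * lucas_U P Q n"
    using assms(7) Un by (simp add: z_def n ratio del: lucas_U.simps)
  define s where "s = (- 1) ^ d * lucas_U P Q n ^ Suc d"
  have U: "lucas_U P Q (Suc d * n) = s * V (Suc d)"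
    "lucas_U P Q (Suc (Suc d * n)) = s * (z * V (Suc d) + (z\<^sup>2 - P * z + Q) * V d)"
    using lucas_U_mult_index[OF z, of d] by (simp_all only: s_def V_def)
  \<comment> \<open>The target ratio has denominator \<open>s * V (Suc d)\<close>; its being nonzero
    lets \<open>s\<close> cancel and supplies the hypothesis on M_d in
    \<open>householder_step_eq\<close>.\<close>
  have s0: "s \<noteq> 0" and V0: "V (Suc d) \<noteq> 0" using UN unfolding U by auto
  have F: "pderiv (pderiv F) = 2" "F \<noteq> 0" "poly F z = z\<^sup>2 - P * z + Q"
    "- poly (pderiv F) z = P - 2 * z"
    by (simp_all add: F_def lucas_poly_def pderiv_pCons P_def Q_def power2_eq_square
        algebra_simps numeral_poly)
  have "y (Suc m) = z + (z\<^sup>2 - P * z + Q) * (V d / V (Suc d))"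
    using householder_step_eq[OF F(1,2) assms(1), of z] assms(5,6) V0
    unfolding F(3,4) by (simp add: V_def F_def z_def del: lucas_U.simps)
  also have "\<dots> = lucas_U P Q (Suc (Suc d * n)) / lucas_U P Q (Suc d * n)"
    unfolding U using s0 V0 by (simp add: field_simps)
  finally show ?thesis unfolding idx ratio .
qed

end
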